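(* For a prime $p$ and a natural number $n$, the minimum degree of the zero divisor graph $\Gamma[\mathbb{Z}_{p^n}]$ is equal to its edge connectivity, i.e. $\delta(\Gamma[\mathbb{Z}_{p^n}]) = \kappa_e(\Gamma[\mathbb{Z}_{p^n}])$. Moreover, for any natural number $n$, $$\kappa(\Gamma[\mathbb{Z}_n]) = \kappa_e(\Gamma[\mathbb{Z}_n]) = \delta(\Gamma[\mathbb{Z}_n]).$$
   Context: $\mathbb{Z}_m$ is the ring of integers modulo $m$. For a commutative ring $R$ with unity, let $Z[R]$ be the set of its zero divisors. The zero divisor graph $\Gamma[R]$ is the simple undirected graph with vertex set $Z^*[R] = Z[R]\setminus\{0\}$ (the non-zero zero divisors of $R$), in which two distinct vertices $v,w$ are adjacent if $vw=0$. For a simple graph $G$: the vertex connectivity $\kappa(G)$ is the smallest number of vertices of $G$ whose deletion from $G$ leaves either a disconnected graph or $K_1$; the edge connectivity $\kappa_e(G)$ is the smallest number of edges of $G$ whose deletion from $G$ leaves either a disconnected graph or an empty graph; the minimum degree $\delta(G)$ is the minimum of the degrees of the vertices of $G$. *)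

theory Defs
  imports "HOL-Number_Theory.Residues"
begin

text \<open>Simple undirected graphs; edges are two-element sets of vertices. All invariants below
  are meant for finite graphs.\<close>

record 'a ugraph =
  vertices :: "'a set"
  edges :: "'a set set"

definition simple_graph :: "'a ugraph \<Rightarrow> bool" where
  "simple_graph G \<longleftrightarrow> (\<forall>e\<in>edges G. e \<subseteq> vertices G \<and> card e = 2)"

definition adjacency :: "'a ugraph \<Rightarrow> ('a \<times> 'a) set" where
  "adjacency G = {(u, v). {u, v} \<in> edges G}"

text \<open>The graph without vertices is not disconnected.\<close>

definition disconnected_graph :: "'a ugraph \<Rightarrow> bool" where
  "disconnected_graph G \<longleftrightarrow> (\<exists>u\<in>vertices G. \<exists>v\<in>vertices G. (u, v) \<notin> (adjacency G)\<^sup>*)"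

definition is_K1 :: "'a ugraph \<Rightarrow> bool" where
  "is_K1 G \<longleftrightarrow> card (vertices G) = 1 \<and> edges G = {}"

text \<open>An empty graph is a graph without edges; it may have vertices.\<close>

definition empty_graph :: "'a ugraph \<Rightarrow> bool" where
  "empty_graph G \<longleftrightarrow> edges G = {}"

definition delete_vertices :: "'a ugraph \<Rightarrow> 'a set \<Rightarrow> 'a ugraph" where
  "delete_vertices G S =
     \<lparr>vertices = vertices G - S, edges = {e \<in> edges G. e \<inter> S = {}}\<rparr>"

definition delete_edges :: "'a ugraph \<Rightarrow> 'a set set \<Rightarrow> 'a ugraph" where
  "delete_edges G F = \<lparr>vertices = vertices G, edges = edges G - F\<rparr>"

definition vertex_degree :: "'a ugraph \<Rightarrow> 'a \<Rightarrow> nat" where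
  "vertex_degree G v = card {e \<in> edges G. v \<in> e}"

text \<open>For the graph without vertices (as for the zero divisor graph of an integral domain) the
  minima defining the minimum degree and the vertex connectivity range over empty sets; both are
  set to 0 there. The edge connectivity of that graph is 0 without a separate convention, because
  it has no edges. For a finite graph with a vertex all three minima are attained.\<close>

definition min_degree :: "'a ugraph \<Rightarrow> nat" where
  "min_degree G =
     (if vertices G = {} then 0 else Min (vertex_degree G ` vertices G))"

definition vertex_connectivity :: "'a ugraph \<Rightarrow> nat" where
  "vertex_connectivity G =
     (if vertices G = {} then 0
      else LEAST k. \<exists>S. S \<subseteq> vertices G \<and> finite S \<and> card S = k \<and>
             (disconnected_graph (delete_vertices G S) \<or> is_K1 (delete_vertices G S)))"

definition edge_connectivity :: "'a ugraph \<Rightarrow> nat" where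
  "edge_connectivity G =
     (LEAST k. \<exists>F. F \<subseteq> edges G \<and> finite F \<and> card F = k \<and>
        (disconnected_graph (delete_edges G F) \<or> empty_graph (delete_edges G F)))"

definition zero_divisors :: "('a, 'b) ring_scheme \<Rightarrow> 'a set" where
  "zero_divisors R =
     {a \<in> carrier R. \<exists>b\<in>carrier R. b \<noteq> \<zero>\<^bsub>R\<^esub> \<and> a \<otimes>\<^bsub>R\<^esub> b = \<zero>\<^bsub>R\<^esub>}"

definition zero_divisor_graph :: "('a, 'b) ring_scheme \<Rightarrow> 'a ugraph" where
  "zero_divisor_graph R =
     \<lparr>vertices = zero_divisors R - {\<zero>\<^bsub>R\<^esub>},
      edges = {{v, w} | v w. v \<in> zero_divisors R - {\<zero>\<^bsub>R\<^esub>} \<and>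
                 w \<in> zero_divisors R - {\<zero>\<^bsub>R\<^esub>} \<and> v \<noteq> w \<and> v \<otimes>\<^bsub>R\<^esub> w = \<zero>\<^bsub>R\<^esub>}\<rparr>"

text \<open>For \<open>n = 1\<close> the library's \<open>residue_ring\<close> has \<open>1\<close> as its unit field although its carrier is
  \<open>{0}\<close>; the zero divisor graph does not refer to the unit, so it is the (vertex-free) graph of
  the zero ring as expected.\<close>

abbreviation Zmod_graph :: "nat \<Rightarrow> int ugraph" where
  "Zmod_graph n \<equiv> zero_divisor_graph (residue_ring (int n))"

lemma simple_zero_divisor_graph: "simple_graph (zero_divisor_graph R)"
  by (auto simp: simple_graph_def zero_divisor_graph_def)

end

theory Submission
  imports Defs
begin

text \<open>For every finite simple graph, \<open>\<kappa> \<le> \<kappa>\<^sub>e \<le> \<delta>\<close> (Whitney), so only \<open>\<delta> \<le> \<kappa>\<close> is specific to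
  \<open>\<Gamma>[\<int>\<^sub>n]\<close>.

  There is nothing to show when \<open>n\<close> is \<open>1\<close> or a prime, because the graph then has no vertices. So
  let \<open>n\<close> be composite. For a prime \<open>q\<close> dividing \<open>n\<close>, the \<open>q - 1\<close> non-zero multiples of
  \<open>n / q\<close> annihilate every multiple of \<open>q\<close>. Let \<open>p\<close> be the least prime divisor of \<open>n\<close>. All
  neighbours of the vertex \<open>p\<close> are multiples of \<open>n / p\<close>, so \<open>\<delta> \<le> p - 1\<close>. A set \<open>S\<close> with fewer
  than \<open>\<delta>\<close> vertices therefore has fewer than \<open>q - 1\<close> elements for every prime \<open>q\<close> dividing \<open>n\<close>,
  and some non-zero multiple \<open>z\<^sub>q\<close> of \<open>n / q\<close> survives its deletion. For \<open>q \<noteq> r\<close> the prime \<open>r\<close>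
  divides \<open>n / q\<close> and hence \<open>z\<^sub>q\<close>, so \<open>z\<^sub>r\<close> annihilates \<open>z\<^sub>q\<close>; and every zero divisor shares a
  prime divisor \<open>q\<close> with \<open>n\<close>, so \<open>z\<^sub>q\<close> annihilates it. Any two surviving vertices \<open>x\<close>, \<open>y\<close> are
  thus joined by a walk \<open>x, z\<^sub>q, z\<^sub>r, y\<close>, in which consecutive vertices may coincide, and deleting
  \<open>S\<close> does not disconnect the graph (\<open>no_small_disconnecting_set_Zmod_graph\<close>). Nor can \<open>S\<close> leave
  a single vertex, since in any graph that takes at least \<open>\<delta>\<close> deletions
  (\<open>connectivities_eq_min_degree\<close>).

  Prime powers get no special treatment: the first claim is an instance of the second.\<close>

section \<open>Separating sets and Whitney's inequalities\<close>

definition vertex_separator :: "'a ugraph \<Rightarrow> 'a set \<Rightarrow> bool" where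
  "vertex_separator G S \<longleftrightarrow> S \<subseteq> vertices G \<and>
     (disconnected_graph (delete_vertices G S) \<or> is_K1 (delete_vertices G S))"

definition edge_separator :: "'a ugraph \<Rightarrow> 'a set set \<Rightarrow> bool" where
  "edge_separator G F \<longleftrightarrow> F \<subseteq> edges G \<and>
     (disconnected_graph (delete_edges G F) \<or> empty_graph (delete_edges G F))"

definition neighbours :: "'a ugraph \<Rightarrow> 'a \<Rightarrow> 'a set" where
  "neighbours G v = {w. {v, w} \<in> edges G}"

definition edge_boundary :: "'a ugraph \<Rightarrow> 'a set \<Rightarrow> 'a set set" where
  "edge_boundary G C = {{a, b} | a b. a \<in> C \<and> b \<notin> C \<and> {a, b} \<in> edges G}"

text \<open>Disconnectedness in terms of a cut. One direction of closure is enough, because \<open>{a, b}\<close> is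
  symmetric in \<open>a\<close> and \<open>b\<close>; the cut obtained from an unreachable pair is the set of vertices
  reachable from its first member.\<close>

lemma disconnected_graph_iff_cut:
  "disconnected_graph G \<longleftrightarrow>
     (\<exists>C. (\<exists>u\<in>vertices G. u \<in> C) \<and> (\<exists>v\<in>vertices G. v \<notin> C) \<and>
          (\<forall>a b. {a, b} \<in> edges G \<longrightarrow> a \<in> C \<longrightarrow> b \<in> C))"
    (is "_ \<longleftrightarrow> ?cut")
proof
  assume "disconnected_graph G"
  then obtain u v where uv: "u \<in> vertices G" "v \<in> vertices G" "(u, v) \<notin> (adjacency G)\<^sup>*"
    by (auto simp: disconnected_graph_def)
  let ?C = "{w. (u, w) \<in> (adjacency G)\<^sup>*}"
  have "b \<in> ?C" if "{a, b} \<in> edges G" "a \<in> ?C" for a b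
    using that by (auto simp: adjacency_def intro: rtrancl_into_rtrancl)
  with uv show ?cut
    by (intro exI[of _ ?C]) blast
next
  assume ?cut
  then obtain C u v where C: "u \<in> vertices G" "u \<in> C" "v \<in> vertices G" "v \<notin> C"
    and closed: "\<And>a b. {a, b} \<in> edges G \<Longrightarrow> a \<in> C \<Longrightarrow> b \<in> C"
    by blast
  have "w \<in> C" if "(u, w) \<in> (adjacency G)\<^sup>*" for w
    using that by induction (auto simp: adjacency_def C intro: closed)
  with C show "disconnected_graph G"
    by (auto simp: disconnected_graph_def)
qed

context
  fixes G :: "'a ugraph"
  assumes simple: "simple_graph G" and fin: "finite (vertices G)"
begin

lemma edge_endpoints:
  assumes "{v, w} \<in> edges G"
  shows "v \<in> vertices G" "w \<in> vertices G" "v \<noteq> w"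
proof -
  have "{v, w} \<subseteq> vertices G" "card {v, w} = 2"
    using simple assms by (auto simp: simple_graph_def simp del: card_insert_disjoint)
  then show "v \<in> vertices G" "w \<in> vertices G" "v \<noteq> w" by auto
qed

lemma edgeE:
  assumes "e \<in> edges G" "v \<in> e"
  obtains w where "e = {v, w}"
proof -
  have "card e = 2" using simple assms by (auto simp: simple_graph_def)
  then show ?thesis using assms(2) that by (auto simp: card_2_iff)
qed

lemma finite_edges: "finite (edges G)"
proof (rule finite_subset)
  show "edges G \<subseteq> Pow (vertices G)" using simple by (auto simp: simple_graph_def)
qed (simp add: fin)

lemma neighbours_subset: "neighbours G v \<subseteq> vertices G - {v}"
  by (auto simp: neighbours_def dest: edge_endpoints)

lemma finite_neighbours: "finite (neighbours G v)"
  using neighbours_subset fin by (meson finite_Diff finite_subset)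

lemma vertex_degree_eq: "vertex_degree G v = card (neighbours G v)"
proof -
  have "{e \<in> edges G. v \<in> e} = (\<lambda>w. {v, w}) ` neighbours G v"
    by (auto simp: neighbours_def elim: edgeE)
  moreover have "inj_on (\<lambda>w. {v, w}) (neighbours G v)"
    by (auto simp: inj_on_def doubleton_eq_iff)
  ultimately show ?thesis
    by (simp add: vertex_degree_def card_image)
qed

lemma min_degree_le: "v \<in> vertices G \<Longrightarrow> min_degree G \<le> vertex_degree G v"
  using fin by (auto simp: min_degree_def)

lemma min_degree_attained:
  assumes "vertices G \<noteq> {}"
  obtains v where "v \<in> vertices G" "vertex_degree G v = min_degree G"
proof -
  have "Min (vertex_degree G ` vertices G) \<in> vertex_degree G ` vertices G"
    using fin assms by (intro Min_in) auto
  moreover have "min_degree G = Min (vertex_degree G ` vertices G)"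
    using assms by (simp add: min_degree_def)
  ultimately show ?thesis using that by (metis imageE)
qed

lemma vertex_connectivity_le: "vertex_separator G S \<Longrightarrow> vertex_connectivity G \<le> card S"
  using fin finite_subset
  by (auto simp: vertex_connectivity_def vertex_separator_def intro!: Least_le)

lemma edge_connectivity_le: "edge_separator G F \<Longrightarrow> edge_connectivity G \<le> card F"
  using finite_edges finite_subset
  by (auto simp: edge_connectivity_def edge_separator_def intro!: Least_le)

text \<open>Deleting the neighbours of \<open>v\<close> isolates it, so either another vertex is left and is cut off
  from \<open>v\<close>, or \<open>v\<close> is all that remains.\<close>

lemma vertex_separator_neighbours:
  assumes v: "v \<in> vertices G"
  shows "vertex_separator G (neighbours G v)"
proof -
  let ?H = "delete_vertices G (neighbours G v)"
  have vH: "v \<in> vertices ?H"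
    using v neighbours_subset by (auto simp: delete_vertices_def)
  have isolated: "{v, b} \<notin> edges ?H" for b
    by (auto simp: delete_vertices_def neighbours_def)
  have "disconnected_graph ?H \<or> is_K1 ?H"
  proof (cases "vertices ?H = {v}")
    case True
    have "e \<notin> edges ?H" for e
    proof
      assume e: "e \<in> edges ?H"
      then have "e \<subseteq> vertices ?H" "card e = 2"
        using simple by (auto simp: simple_graph_def delete_vertices_def)
      with True show False using card_mono[of "{v}" e] by simp
    qed
    then show ?thesis using True by (auto simp: is_K1_def)
  next
    case False
    then obtain u where "u \<in> vertices ?H" "u \<noteq> v" using vH by auto
    then have "disconnected_graph ?H"
      unfolding disconnected_graph_iff_cut
      using vH isolated by (intro exI[of _ "{v}"]) auto
    then show ?thesis ..
  qed
  then show ?thesis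
    using neighbours_subset by (auto simp: vertex_separator_def)
qed

lemma vertex_connectivity_attained:
  assumes "vertices G \<noteq> {}"
  obtains S where "vertex_separator G S" "card S = vertex_connectivity G"
proof -
  let ?P = "\<lambda>k. \<exists>S. S \<subseteq> vertices G \<and> finite S \<and> card S = k \<and>
    (disconnected_graph (delete_vertices G S) \<or> is_K1 (delete_vertices G S))"
  obtain v where "v \<in> vertices G" using assms by auto
  then have "?P (card (neighbours G v))"
    using vertex_separator_neighbours finite_neighbours unfolding vertex_separator_def by blast
  then have "?P (LEAST k. ?P k)" by (rule LeastI)
  with that assms show ?thesis
    by (auto simp: vertex_connectivity_def vertex_separator_def)
qed

lemma edge_connectivity_attained:
  obtains F where "edge_separator G F" "card F = edge_connectivity G"
proof -
  let ?P = "\<lambda>k. \<exists>F. F \<subseteq> edges G \<and> finite F \<and> card F = k \<and>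
    (disconnected_graph (delete_edges G F) \<or> empty_graph (delete_edges G F))"
  have "?P (card (edges G))"
    using finite_edges
    by (intro exI[of _ "edges G"]) (auto simp: delete_edges_def empty_graph_def)
  then have "?P (LEAST k. ?P k)" by (rule LeastI)
  with that show ?thesis
    by (auto simp: edge_connectivity_def edge_separator_def)
qed

lemma vertex_connectivity_le_min_degree: "vertex_connectivity G \<le> min_degree G"
proof (cases "vertices G = {}")
  case True
  then show ?thesis by (simp add: vertex_connectivity_def)
next
  case False
  then obtain v where "v \<in> vertices G" "vertex_degree G v = min_degree G"
    by (rule min_degree_attained)
  then show ?thesis
    using vertex_connectivity_le[OF vertex_separator_neighbours] vertex_degree_eq by metis
qed

text \<open>The edges at a vertex \<open>v\<close> of minimum degree form a separator: without them \<open>v\<close> is isolated,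
  and if \<open>v\<close> is the only vertex then there are no edges at all.\<close>

lemma edge_connectivity_le_min_degree: "edge_connectivity G \<le> min_degree G"
proof (cases "edges G = {}")
  case True
  then have "edge_separator G {}"
    by (auto simp: edge_separator_def delete_edges_def empty_graph_def)
  from edge_connectivity_le[OF this] show ?thesis by simp
next
  case False
  then obtain e where e: "e \<in> edges G" by auto
  then have "e \<subseteq> vertices G" "card e = 2" using simple by (auto simp: simple_graph_def)
  then obtain a b where ab: "a \<in> vertices G" "b \<in> vertices G" "a \<noteq> b"
    by (auto simp: card_2_iff)
  then have "vertices G \<noteq> {}" by auto
  then obtain v where v: "v \<in> vertices G" "vertex_degree G v = min_degree G"
    by (rule min_degree_attained)
  obtain u where "u \<in> vertices G" "u \<noteq> v" using ab by metis
  then have "disconnected_graph (delete_edges G {e \<in> edges G. v \<in> e})"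
    unfolding disconnected_graph_iff_cut
    using v by (intro exI[of _ "{v}"]) (auto simp: delete_edges_def)
  then have "edge_separator G {e \<in> edges G. v \<in> e}"
    by (auto simp: edge_separator_def)
  from edge_connectivity_le[OF this] v show ?thesis
    by (simp add: vertex_degree_def)
qed

lemma edge_boundary_subset: "edge_boundary G C \<subseteq> edges G"
  by (auto simp: edge_boundary_def)

text \<open>If every vertex of \<open>C\<close> met the boundary, then the neighbours of \<open>x\<close> could be mapped
  injectively to boundary edges: a neighbour outside \<open>C\<close> to the edge joining it to \<open>x\<close>, and a
  neighbour inside \<open>C\<close> to some boundary edge at that neighbour. This is injective because a
  boundary edge has only one end in \<open>C\<close>, which is \<open>x\<close> for edges of the first kind and a vertex
  other than \<open>x\<close> for those of the second.\<close>

lemma vertex_avoiding_small_edge_boundary: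
  assumes x: "x \<in> C" "x \<in> vertices G"
    and small: "card (edge_boundary G C) < vertex_degree G x"
  obtains u where "u \<in> C" "u \<in> vertices G" "\<forall>e\<in>edge_boundary G C. u \<notin> e"
proof (rule ccontr)
  assume "\<not> thesis"
  with that have "\<forall>u. u \<in> C \<and> u \<in> vertices G \<longrightarrow> (\<exists>e\<in>edge_boundary G C. u \<in> e)"
    by blast
  then obtain h where h: "\<And>u. u \<in> C \<Longrightarrow> u \<in> vertices G \<Longrightarrow> h u \<in> edge_boundary G C \<and> u \<in> h u"
    by metis
  define g where "g w = (if w \<in> C then h w else {x, w})" for w
  have h_C: "h u \<inter> C = {u}" if "u \<in> C" "u \<in> vertices G" for u
    using h[OF that] that by (auto simp: edge_boundary_def)
  have "inj_on g (neighbours G x)"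
  proof (rule inj_onI)
    fix v w
    assume vw: "v \<in> neighbours G x" "w \<in> neighbours G x" and eq: "g v = g w"
    have V: "v \<in> vertices G" "w \<in> vertices G" "v \<noteq> x" "w \<noteq> x"
      using vw neighbours_subset by blast+
    have g_C: "g a \<inter> C = (if a \<in> C then {a} else {x})" if "a \<in> vertices G" for a
      using that h_C x by (auto simp: g_def)
    from eq have "g v \<inter> C = g w \<inter> C" by simp
    then have "v = w \<or> v \<notin> C \<and> w \<notin> C"
      using g_C V by (auto split: if_splits)
    then show "v = w"
      using eq by (auto simp: g_def doubleton_eq_iff)
  qed
  moreover have "g ` neighbours G x \<subseteq> edge_boundary G C"
  proof
    fix e assume "e \<in> g ` neighbours G x"
    then obtain w where w: "{x, w} \<in> edges G" "e = g w" by (auto simp: neighbours_def)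
    then show "e \<in> edge_boundary G C"
      using h[of w] edge_endpoints(2)[OF w(1)] x(1) by (auto simp: g_def edge_boundary_def)
  qed
  moreover have "finite (edge_boundary G C)"
    using edge_boundary_subset finite_edges finite_subset by blast
  ultimately have "card (neighbours G x) \<le> card (edge_boundary G C)"
    by (rule card_inj_on_le)
  with small show False by (simp add: vertex_degree_eq)
qed

text \<open>Replace the edges across a cut \<open>C\<close> by their ends in \<open>C\<close>. These ends separate the graph provided
  that they do not exhaust \<open>C\<close>; if fewer than \<open>\<delta>\<close> edges were deleted, the preceding lemma yields a
  vertex of \<open>C\<close> that is left over, and otherwise \<open>\<kappa> \<le> \<delta>\<close> already suffices.\<close>

lemma vertex_connectivity_le_edge_connectivity: "vertex_connectivity G \<le> edge_connectivity G"
proof (cases "vertices G = {} \<or> min_degree G \<le> edge_connectivity G")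
  case True
  then show ?thesis
  proof
    assume "vertices G = {}"
    then show ?thesis by (simp add: vertex_connectivity_def)
  next
    assume "min_degree G \<le> edge_connectivity G"
    with vertex_connectivity_le_min_degree show ?thesis by (rule le_trans)
  qed
next
  case False
  obtain F where F: "edge_separator G F" "card F = edge_connectivity G"
    by (rule edge_connectivity_attained)
  have finF: "finite F"
    using F finite_edges finite_subset by (auto simp: edge_separator_def)
  have less: "card F < vertex_degree G v" if "v \<in> vertices G" for v
    using min_degree_le[OF that] False F(2) by simp
  have "\<not> empty_graph (delete_edges G F)"
  proof
    assume "empty_graph (delete_edges G F)"
    then have "edges G \<subseteq> F" by (auto simp: empty_graph_def delete_edges_def)
    then have "vertex_degree G v \<le> card F" for v
      unfolding vertex_degree_def using finF by (intro card_mono) auto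
    with less False show False by (metis equals0I not_less)
  qed
  with F have "disconnected_graph (delete_edges G F)"
    by (auto simp: edge_separator_def)
  then obtain C x v where C: "x \<in> C" "x \<in> vertices G" "v \<notin> C" "v \<in> vertices G"
    and closed: "\<And>a b. {a, b} \<in> edges G - F \<Longrightarrow> a \<in> C \<Longrightarrow> b \<in> C"
    by (auto simp: disconnected_graph_iff_cut delete_edges_def)
  have KF: "edge_boundary G C \<subseteq> F"
    using closed by (auto simp: edge_boundary_def)
  have "card (edge_boundary G C) < vertex_degree G x"
    using card_mono[OF finF KF] less[OF C(2)] by simp
  with C obtain u where u: "u \<in> C" "u \<in> vertices G" "\<forall>e\<in>edge_boundary G C. u \<notin> e"
    by (rule_tac vertex_avoiding_small_edge_boundary)
  define S where "S = {a \<in> C. \<exists>b. b \<notin> C \<and> {a, b} \<in> edges G}"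
  have "a \<in> (\<lambda>e. the_elem (e \<inter> C)) ` edge_boundary G C" if "a \<in> S" for a
  proof -
    from that obtain b where b: "a \<in> C" "b \<notin> C" "{a, b} \<in> edges G" by (auto simp: S_def)
    then have "{a, b} \<inter> C = {a}" by auto
    then have "a = the_elem ({a, b} \<inter> C)" by simp
    moreover have "{a, b} \<in> edge_boundary G C" using b by (auto simp: edge_boundary_def)
    ultimately show ?thesis by (rule image_eqI)
  qed
  then have "card S \<le> card (edge_boundary G C)"
    using finite_subset[OF KF finF] by (intro surj_card_le) auto
  also have "\<dots> \<le> card F" by (rule card_mono[OF finF KF])
  finally have card_S: "card S \<le> edge_connectivity G" using F by simp
  have "u \<notin> S"
  proof
    assume "u \<in> S"
    then obtain b where "b \<notin> C" "{u, b} \<in> edges G" by (auto simp: S_def)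
    with u(1) have "{u, b} \<in> edge_boundary G C" by (auto simp: edge_boundary_def)
    with u(3) show False by auto
  qed
  then have "disconnected_graph (delete_vertices G S)"
    unfolding disconnected_graph_iff_cut
  proof (intro exI[of _ C] conjI bexI allI impI)
    fix a b assume "{a, b} \<in> edges (delete_vertices G S)" "a \<in> C"
    then show "b \<in> C" by (auto simp: delete_vertices_def S_def)
  qed (use u C in \<open>auto simp: delete_vertices_def S_def\<close>)
  moreover have "S \<subseteq> vertices G"
    by (auto simp: S_def dest: edge_endpoints)
  ultimately have "vertex_separator G S" by (simp add: vertex_separator_def)
  from vertex_connectivity_le[OF this] card_S show ?thesis by simp
qed

text \<open>By Whitney's inequalities the three invariants agree as soon as \<open>\<delta> \<le> \<kappa>\<close>. Only disconnection
  has to be excluded: leaving a single vertex takes \<open>card (vertices G) - 1 \<ge> \<delta>\<close> deletions.\<close>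

lemma connectivities_eq_min_degree:
  assumes connected: "\<And>S. S \<subseteq> vertices G \<Longrightarrow> card S < min_degree G \<Longrightarrow>
    \<not> disconnected_graph (delete_vertices G S)"
  shows "vertex_connectivity G = edge_connectivity G \<and> edge_connectivity G = min_degree G"
proof -
  have "min_degree G \<le> vertex_connectivity G"
  proof (cases "vertices G = {}")
    case True
    then show ?thesis by (simp add: min_degree_def)
  next
    case False
    then obtain S where S: "vertex_separator G S" "card S = vertex_connectivity G"
      by (rule vertex_connectivity_attained)
    show ?thesis
    proof (rule ccontr)
      assume small: "\<not> ?thesis"
      with S connected have "is_K1 (delete_vertices G S)" and sub: "S \<subseteq> vertices G"
        by (auto simp: vertex_separator_def)
      then have "card (vertices G - S) = 1"
        by (simp add: is_K1_def delete_vertices_def)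
      then have card_S: "card (vertices G) = card S + 1"
        using sub fin finite_subset[OF sub fin] card_mono[OF fin sub] by (simp add: card_Diff_subset)
      obtain v where v: "v \<in> vertices G" using False by auto
      have "min_degree G \<le> card (neighbours G v)"
        using min_degree_le[OF v] by (simp add: vertex_degree_eq)
      also have "\<dots> \<le> card (vertices G - {v})"
        using neighbours_subset fin by (intro card_mono) auto
      also have "\<dots> = card S" using v fin card_S by simp
      finally show False using S small by simp
    qed
  qed
  then show ?thesis
    using vertex_connectivity_le_edge_connectivity edge_connectivity_le_min_degree by simp
qed

end

section \<open>The zero divisor graph of the integers modulo \<open>n\<close>\<close>

lemma vertices_Zmod_graph:
  "vertices (Zmod_graph n) =
     {x. 0 < x \<and> x < int n \<and> (\<exists>b. 0 < b \<and> b < int n \<and> int n dvd x * b)}"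
proof -
  have carrier_nonzero: "b \<in> carrier (residue_ring (int n)) \<and> b \<noteq> \<zero>\<^bsub>residue_ring (int n)\<^esub> \<longleftrightarrow>
      0 < b \<and> b < int n" for b
    by (auto simp: residue_ring_def)
  have "x \<otimes>\<^bsub>residue_ring (int n)\<^esub> b = \<zero>\<^bsub>residue_ring (int n)\<^esub> \<longleftrightarrow> int n dvd x * b" for x b
    by (simp add: residue_ring_def mod_eq_0_iff_dvd)
  with carrier_nonzero show ?thesis
    unfolding zero_divisor_graph_def zero_divisors_def by simp blast
qed

lemma edge_Zmod_graph_iff:
  "{v, w} \<in> edges (Zmod_graph n) \<longleftrightarrow>
     v \<in> vertices (Zmod_graph n) \<and> w \<in> vertices (Zmod_graph n) \<and> v \<noteq> w \<and> int n dvd v * w"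
  by (auto simp: zero_divisor_graph_def residue_ring_def mod_eq_0_iff_dvd doubleton_eq_iff
      mult.commute)

lemma finite_vertices_Zmod_graph: "finite (vertices (Zmod_graph n))"
  by (rule finite_subset[of _ "{0..int n}"]) (auto simp: vertices_Zmod_graph)

text \<open>The non-zero elements of the annihilator of \<open>q\<close> in \<open>\<int>\<^sub>n\<close>, for a divisor \<open>q\<close> of \<open>n > 0\<close>.\<close>

definition annihilators :: "nat \<Rightarrow> nat \<Rightarrow> int set" where
  "annihilators n q = (\<lambda>j. int j * int (n div q)) ` {1..<q}"

lemma card_annihilators:
  assumes "q dvd n" "0 < n"
  shows "card (annihilators n q) = q - 1"
proof -
  have "n div q \<noteq> 0" using assms by (auto elim!: dvdE)
  then have "inj_on (\<lambda>j. int j * int (n div q)) {1..<q}"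
    by (auto simp: inj_on_def)
  then show ?thesis by (simp add: annihilators_def card_image)
qed

lemma annihilators_mult:
  assumes "q dvd n" "int q dvd x" "z \<in> annihilators n q"
  shows "int n dvd x * z"
proof -
  have "int n = int q * int (n div q)" using assms(1) by (metis dvd_mult_div_cancel of_nat_mult)
  moreover have "int q * int (n div q) dvd x * z"
    using assms(2,3) by (intro mult_dvd_mono) (auto simp: annihilators_def)
  ultimately show ?thesis by simp
qed

lemma annihilators_subset_vertices:
  assumes "q dvd n" "0 < n" "q < n"
  shows "annihilators n q \<subseteq> vertices (Zmod_graph n)"
proof
  fix z assume z: "z \<in> annihilators n q"
  then obtain j where "z = int j * int (n div q)" "j \<in> {1..<q}"
    unfolding annihilators_def by (rule imageE)
  then have j: "z = int j * int (n div q)" "1 \<le> j" "j < q" by simp_all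
  have nq: "n = q * (n div q)" and pos: "0 < n div q"
    using assms by (auto elim!: dvdE)
  have "j * (n div q) < q * (n div q)" using j pos by simp
  then have "z < int n" using j nq by (metis of_nat_less_iff of_nat_mult)
  moreover have "0 < z" using j pos by simp
  moreover have "int n dvd z * int q"
    using annihilators_mult[OF assms(1) dvd_refl z] by (simp add: mult.commute)
  ultimately show "z \<in> vertices (Zmod_graph n)"
    using assms j by (auto simp: vertices_Zmod_graph intro!: exI[of _ "int q"])
qed

lemma neighbours_subset_annihilators:
  assumes "q dvd n" "0 < n"
  shows "neighbours (Zmod_graph n) (int q) \<subseteq> annihilators n q"
proof
  fix w assume "w \<in> neighbours (Zmod_graph n) (int q)"
  then have w: "0 < w" "w < int n" "int n dvd int q * w"
    by (auto simp: neighbours_def edge_Zmod_graph_iff vertices_Zmod_graph)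
  have nq: "int n = int q * int (n div q)" and q0: "q \<noteq> 0" and pos: "0 < n div q"
    using assms by (auto elim!: dvdE)
  from w(3) have "int (n div q) dvd w" using nq q0 by simp
  then obtain k where k: "w = int (n div q) * k" by (elim dvdE)
  have "0 < k" using w(1) pos k by (simp add: zero_less_mult_iff)
  moreover have "int (n div q) * k < int (n div q) * int q"
    using w(2) nq k by (simp add: mult.commute)
  then have "k < int q" using pos by simp
  ultimately show "w \<in> annihilators n q"
    unfolding annihilators_def using k
    by (intro image_eqI[of _ _ "nat k"]) auto
qed

text \<open>If \<open>x\<close> were coprime to \<open>n\<close>, it could be cancelled from \<open>n dvd x * b\<close>. The inequality,
  which holds because \<open>q\<close> divides \<open>x < n\<close>, shows that \<open>\<Gamma>[\<int>\<^sub>n]\<close> has no vertices when \<open>n\<close> is prime.\<close>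

lemma vertex_prime_divisor:
  assumes "x \<in> vertices (Zmod_graph n)"
  obtains q where "prime q" "q dvd n" "int q dvd x" "q < n"
proof -
  from assms obtain b where x: "0 < x" "x < int n" and b: "0 < b" "b < int n" "int n dvd x * b"
    by (auto simp: vertices_Zmod_graph)
  have "\<not> coprime x (int n)"
  proof
    assume "coprime x (int n)"
    then have "int n dvd b"
      using b(3) by (simp add: coprime_commute coprime_dvd_mult_right_iff)
    with b show False using zdvd_imp_le by fastforce
  qed
  moreover define y where "y = nat x"
  ultimately have "\<not> coprime y n" and xy: "x = int y"
    using x by (auto simp flip: coprime_int_iff)
  then obtain q where q: "prime q" "q dvd y" "q dvd n"
    using prime_factor_nat[of "gcd y n"] by (auto simp: coprime_iff_gcd_eq_1)
  have "q \<le> y" using q x xy by (auto intro: dvd_imp_le)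
  then have "q < n" using x xy by simp
  with q that xy show ?thesis by simp
qed

text \<open>Every vertex has a neighbour (or itself) among the multiples of \<open>n / q\<close> for some prime \<open>q\<close>
  dividing \<open>n\<close>, and a set smaller than the degree of the least prime divisor of \<open>n\<close> is too small to
  contain all non-zero multiples of any \<open>n / q\<close>. One surviving multiple for each \<open>q\<close> keeps the rest
  together.\<close>

lemma no_small_disconnecting_set_Zmod_graph:
  assumes sub: "S \<subseteq> vertices (Zmod_graph n)"
    and S: "card S < min_degree (Zmod_graph n)"
  shows "\<not> disconnected_graph (delete_vertices (Zmod_graph n) S)"
proof (cases "vertices (Zmod_graph n) = {}")
  case True
  then show ?thesis by (simp add: disconnected_graph_def delete_vertices_def)
next
  case False
  let ?G = "Zmod_graph n"
  let ?H = "delete_vertices ?G S"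
  let ?p = "LEAST p. prime p \<and> p dvd n"
  from False obtain x0 q0 where x0: "x0 \<in> vertices ?G" and q0: "prime q0" "q0 dvd n" "q0 < n"
    using vertex_prime_divisor by blast
  then have n: "0 < n" by simp
  have p: "prime ?p" "?p dvd n"
    using LeastI[of "\<lambda>p. prime p \<and> p dvd n" q0] q0 by auto
  have p_le: "?p \<le> q" if "prime q" "q dvd n" for q
    using that by (intro Least_le) simp
  \<comment> \<open>Since there is a vertex, \<open>n\<close> is not prime.\<close>
  have proper: "q < n" if "prime q" "q dvd n" for q
  proof -
    have "q \<noteq> n" using that q0 by (metis nat_neq_iff prime_nat_iff)
    then show ?thesis using dvd_imp_le[OF that(2) n] by simp
  qed
  have "1 < ?p" using p(1) prime_gt_1_nat by blast
  have "int n dvd int ?p * int (n div ?p)"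
    using p(2) by (metis dvd_mult_div_cancel dvd_refl of_nat_mult)
  moreover have "0 < n div ?p" "n div ?p < n"
    using p(2) n \<open>1 < ?p\<close> by (auto simp: dvd_div_eq_0_iff intro: Nat.gr0I)
  ultimately have "int ?p \<in> vertices ?G"
    using proper[OF p] \<open>1 < ?p\<close>
    by (auto simp: vertices_Zmod_graph intro!: exI[of _ "int (n div ?p)"])
  then have "min_degree ?G \<le> card (neighbours ?G (int ?p))"
    using min_degree_le[OF simple_zero_divisor_graph finite_vertices_Zmod_graph]
      vertex_degree_eq[OF simple_zero_divisor_graph finite_vertices_Zmod_graph] by metis
  also have "\<dots> \<le> card (annihilators n ?p)"
    using neighbours_subset_annihilators[OF p(2) n]
    by (intro card_mono) (auto simp: annihilators_def)
  also have "\<dots> = ?p - 1" by (rule card_annihilators[OF p(2) n])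
  finally have S_less: "card S < ?p - 1" using S by simp

  have "\<exists>z. z \<in> annihilators n q \<and> z \<notin> S" if "prime q" "q dvd n" for q
  proof (rule ccontr)
    assume "\<not> ?thesis"
    then have "annihilators n q \<subseteq> S" by blast
    moreover have "finite S"
      using sub finite_vertices_Zmod_graph by (rule finite_subset)
    ultimately have "q - 1 \<le> card S" using card_annihilators[OF that(2) n] card_mono by metis
    with S_less p_le[OF that] show False by simp
  qed
  then obtain z where z: "\<And>q. prime q \<Longrightarrow> q dvd n \<Longrightarrow> z q \<in> annihilators n q \<and> z q \<notin> S"
    by metis
  have z_H: "z q \<in> vertices ?H" if "prime q" "q dvd n" for q
    using z[OF that] annihilators_subset_vertices[OF that(2) n proper[OF that]]
    by (auto simp: delete_vertices_def)
  \<comment> \<open>Equality is allowed here because a vertex of the walk may itself be one of the \<open>z q\<close>.\<close>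
  have step: "(x, y) \<in> (adjacency ?H)\<^sup>*"
    if "x \<in> vertices ?H" "y \<in> vertices ?H" "int n dvd x * y" for x y
  proof (cases "x = y")
    case False
    then have "{x, y} \<in> edges ?H"
      using that by (auto simp: delete_vertices_def edge_Zmod_graph_iff)
    then show ?thesis by (auto simp: adjacency_def)
  qed simp
  have z_z: "(z q, z r) \<in> (adjacency ?H)\<^sup>*"
    if q: "prime q" "q dvd n" and r: "prime r" "r dvd n" for q r
  proof (cases "q = r")
    case False
    have "r dvd n div q"
      using q r False by (metis dvd_mult_div_cancel prime_dvd_mult_iff primes_dvd_imp_eq)
    then have "int r dvd z q"
      using z[OF q] by (auto simp: annihilators_def)
    then have "int n dvd z q * z r" using annihilators_mult[OF r(2)] z[OF r] by blast
    then show ?thesis using step z_H q r by blast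
  qed simp
  have "(x, y) \<in> (adjacency ?H)\<^sup>*" if x: "x \<in> vertices ?H" and y: "y \<in> vertices ?H" for x y
  proof -
    obtain q where q: "prime q" "q dvd n" "int q dvd x"
      using vertex_prime_divisor[of x n] x by (auto simp: delete_vertices_def)
    obtain r where r: "prime r" "r dvd n" "int r dvd y"
      using vertex_prime_divisor[of y n] y by (auto simp: delete_vertices_def)
    have "(x, z q) \<in> (adjacency ?H)\<^sup>*"
      using step[OF x z_H] annihilators_mult[OF q(2,3)] z q by blast
    also have "(z q, z r) \<in> (adjacency ?H)\<^sup>*" using z_z q r by blast
    also have "(z r, y) \<in> (adjacency ?H)\<^sup>*"
      using step[OF z_H y] annihilators_mult[OF r(2,3)] z r by (metis mult.commute)
    finally show ?thesis .
  qed
  then show ?thesis by (auto simp: disconnected_graph_def)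
qed

lemma Zmod_graph_connectivities:
  "vertex_connectivity (Zmod_graph n) = edge_connectivity (Zmod_graph n) \<and>
   edge_connectivity (Zmod_graph n) = min_degree (Zmod_graph n)"
  by (intro connectivities_eq_min_degree simple_zero_divisor_graph finite_vertices_Zmod_graph
      no_small_disconnecting_set_Zmod_graph)

theorem theorem4p5:
  "(\<forall>(p::nat) (k::nat). prime p \<longrightarrow>
      min_degree (Zmod_graph (p ^ k)) = edge_connectivity (Zmod_graph (p ^ k))) \<and>
   (\<forall>n::nat. n \<ge> 1 \<longrightarrow>
      vertex_connectivity (Zmod_graph n) = edge_connectivity (Zmod_graph n) \<and>
      edge_connectivity (Zmod_graph n) = min_degree (Zmod_graph n))"
  using Zmod_graph_connectivities by metis

end
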